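(* Let $G$ be a unique product monoid and $S=R*G$ a crossed product. Let $M$ be a nonzero right $R$-module. The following conditions are equivalent. (1) $M$ is $S$-prime, i.e. the right $S$-module $M\otimes_R S$ is prime. (2) If $m\in M$, $b\in R$, $g\in G$, and $mR^g(b^h)^g=0$ for all $h\in G$, then either $m=0$ or $Mb^h=0$ for all $h\in G$. (3) If $m\in M$, $B$ is a $G$-stable ideal of $R$, and $mB^g=0$ for some $g\in G$, then $m=0$ or $MB=0$. If $R$ is commutative or $\sigma$ is pointwise surjective, the following condition is also equivalent to these: (4) If $N$ is a submodule of $M$, $B$ is a $G$-stable ideal of $R$, and $NB^g=0$ for some $g\in G$, then $N=0$ or $MB=0$.
   Context: Rings have $1$, modules are unital right modules, ideals are two-sided. A unique product monoid is a monoid $G$ (identity $e$) such that whenever $X,Y$ are nonempty finite subsets of $G$, there exist $x\in X$, $y\in Y$ with $xy\ne x'y'$ for every pair $(x',y')\in X\times Y$ different from $(x,y)$. A crossed product $S=R*G$ is determined by a ring $R$, a monoid $G$, and functions $\sigma:G\to\operatorname{End}_{\mathrm{Ring}}(R)$ and $c:G\times G\to GL_1(R)$ (units of $R$); write $r^g=\sigma(g)(r)$ and $X^g=\{x^g:x\in X\}$ for $X\subseteq R$. $S=\bigoplus_{g\in G}R\overline{g}$ is a free left $R$-module with basis $\{\overline g:g\in G\}$ and multiplication determined by $\overline g\, r=r^g\,\overline g$ and $\overline g\,\overline h=c(g,h)\overline{gh}$, where for all $r\in R$, $g,h,i\in G$: $r^e=r$; $c(g,e)=c(e,g)=1$; $(r^h)^g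 c(g,h)=c(g,h)r^{gh}$; $c(g,h)c(gh,i)=c(h,i)^g c(g,hi)$. $R$ is identified with $R\overline e$. The induced module $M\otimes_R S$ can be identified with $M*G=\bigoplus_{g\in G}M\overline g$, with $m\overline g\cdot r\overline h=m r^g c(g,h)\overline{gh}$. $\sigma$ is pointwise surjective if $\sigma(g)$ is surjective for all $g\in G$. An ideal $I$ of $R$ is $G$-stable if $I^g\subseteq I$ for all $g\in G$. A nonzero module is prime if all its nonzero submodules have the same annihilator as the module itself. *)

theory Defs
  imports Complex_Main "HOL-Library.Poly_Mapping"
begin

section \<open>Rings and right modules\<close>

text \<open>Base rings are types of class \<^class>\<open>ring_1\<close>. The multiplication of a crossed product depends on
  \<open>\<sigma>\<close> and \<open>c\<close>, so it cannot be a class instance. Modules are therefore defined over a ring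
  whose multiplication and identity are explicit; a base ring is the instance \<open>(*)\<close>, \<open>1\<close>.
  (The locale \<open>module\<close> of the library needs commutative scalars.)\<close>

locale unital_ring =
  fixes mult :: "'s::ab_group_add \<Rightarrow> 's \<Rightarrow> 's" and one :: 's
  assumes mult_assoc: "mult (mult a b) c = mult a (mult b c)"
    and mult_add_left: "mult (a + b) c = mult a c + mult b c"
    and mult_add_right: "mult a (b + c) = mult a b + mult a c"
    and mult_one_left: "mult one a = a"
    and mult_one_right: "mult a one = a"

locale right_module = unital_ring mult one
  for mult :: "'s::ab_group_add \<Rightarrow> 's \<Rightarrow> 's" and one :: 's +
  fixes act :: "'m::ab_group_add \<Rightarrow> 's \<Rightarrow> 'm"
  assumes act_add_left: "act (x + y) s = act x s + act y s"
    and act_add_right: "act x (s + t) = act x s + act x t"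
    and act_act: "act (act x s) t = act x (mult s t)"
    and act_one: "act x one = x"

definition submodule :: "('m::ab_group_add \<Rightarrow> 's \<Rightarrow> 'm) \<Rightarrow> 'm set \<Rightarrow> bool" where
  "submodule act N \<longleftrightarrow>
     0 \<in> N \<and> (\<forall>x\<in>N. \<forall>y\<in>N. x + y \<in> N) \<and> (\<forall>x\<in>N. \<forall>s. act x s \<in> N)"

definition annihilator :: "('m::ab_group_add \<Rightarrow> 's \<Rightarrow> 'm) \<Rightarrow> 'm set \<Rightarrow> 's set" where
  "annihilator act N = {s. \<forall>x\<in>N. act x s = 0}"

definition prime_module ::
  "('s::ab_group_add \<Rightarrow> 's \<Rightarrow> 's) \<Rightarrow> 's \<Rightarrow> ('m::ab_group_add \<Rightarrow> 's \<Rightarrow> 'm) \<Rightarrow> bool" where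
  "prime_module mult one act \<longleftrightarrow>
     right_module mult one act \<and> (\<exists>x::'m. x \<noteq> 0) \<and>
     (\<forall>N. submodule act N \<and> N \<noteq> {0} \<longrightarrow> annihilator act N = annihilator act UNIV)"

definition two_sided_ideal :: "'r::ring_1 set \<Rightarrow> bool" where
  "two_sided_ideal I \<longleftrightarrow>
     0 \<in> I \<and> (\<forall>x\<in>I. \<forall>y\<in>I. x + y \<in> I) \<and> (\<forall>x\<in>I. \<forall>r. r * x \<in> I \<and> x * r \<in> I)"

definition is_unit_of_ring :: "'r::ring_1 \<Rightarrow> bool" where
  "is_unit_of_ring u \<longleftrightarrow> (\<exists>v. u * v = 1 \<and> v * u = 1)"

definition ring_endo :: "('r::ring_1 \<Rightarrow> 'r) \<Rightarrow> bool" where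
  "ring_endo f \<longleftrightarrow>
     f 1 = 1 \<and> (\<forall>x y. f (x + y) = f x + f y) \<and> (\<forall>x y. f (x * y) = f x * f y)"


section \<open>Unique product monoids\<close>

definition unique_product_monoid :: "'g::monoid_mult itself \<Rightarrow> bool" where
  "unique_product_monoid TYPE('g) \<longleftrightarrow>
     (\<forall>X Y :: 'g set. finite X \<and> X \<noteq> {} \<and> finite Y \<and> Y \<noteq> {} \<longrightarrow>
        (\<exists>x\<in>X. \<exists>y\<in>Y. \<forall>(x', y') \<in> X \<times> Y. (x', y') \<noteq> (x, y) \<longrightarrow> x * y \<noteq> x' * y'))"


section \<open>Crossed products and induced modules\<close>

text \<open>\<open>\<sigma> g r\<close> is \<open>r\<^sup>g\<close>.\<close>

locale crossed_product =
  fixes \<sigma> :: "'g::monoid_mult \<Rightarrow> 'r::ring_1 \<Rightarrow> 'r"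
    and c :: "'g \<Rightarrow> 'g \<Rightarrow> 'r"
  assumes endo: "ring_endo (\<sigma> g)"
    and unit_c: "is_unit_of_ring (c g h)"
    and sigma_one: "\<sigma> 1 r = r"
    and c_one_right: "c g 1 = 1"
    and c_one_left: "c 1 g = 1"
    and twisted_action: "\<sigma> g (\<sigma> h r) * c g h = c g h * \<sigma> (g * h) r"
    and cocycle: "c g h * c (g * h) i = \<sigma> g (c h i) * c g (h * i)"

text \<open>An element \<open>\<Sum>\<^sub>g r\<^sub>g \<cdot> g-bar\<close> of \<open>S = R * G\<close> is the finitely supported function
  \<open>g \<mapsto> r\<^sub>g\<close>, i.e. \<open>Poly_Mapping.single g r\<close> is \<open>r \<cdot> g-bar\<close>; likewise for \<open>M * G\<close>.\<close>

definition crossed_mult ::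
  "('g::monoid_mult \<Rightarrow> 'r::ring_1 \<Rightarrow> 'r) \<Rightarrow> ('g \<Rightarrow> 'g \<Rightarrow> 'r) \<Rightarrow>
     ('g \<Rightarrow>\<^sub>0 'r) \<Rightarrow> ('g \<Rightarrow>\<^sub>0 'r) \<Rightarrow> ('g \<Rightarrow>\<^sub>0 'r)" where
  "crossed_mult \<sigma> c s t =
     (\<Sum>g\<in>Poly_Mapping.keys s. \<Sum>h\<in>Poly_Mapping.keys t.
        Poly_Mapping.single (g * h)
          (Poly_Mapping.lookup s g * \<sigma> g (Poly_Mapping.lookup t h) * c g h))"

definition crossed_one :: "'g::monoid_mult \<Rightarrow>\<^sub>0 'r::ring_1" where
  "crossed_one = Poly_Mapping.single 1 1"

text \<open>The right action of \<open>S\<close> on \<open>M * G\<close>, the standard model of \<open>M \<otimes>\<^sub>R S\<close>; the universal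
  property of the tensor product is proved at the end of this theory.\<close>

definition induced_act ::
  "('g::monoid_mult \<Rightarrow> 'r::ring_1 \<Rightarrow> 'r) \<Rightarrow> ('g \<Rightarrow> 'g \<Rightarrow> 'r) \<Rightarrow>
     ('m::ab_group_add \<Rightarrow> 'r \<Rightarrow> 'm) \<Rightarrow> ('g \<Rightarrow>\<^sub>0 'm) \<Rightarrow> ('g \<Rightarrow>\<^sub>0 'r) \<Rightarrow> ('g \<Rightarrow>\<^sub>0 'm)" where
  "induced_act \<sigma> c act x s =
     (\<Sum>g\<in>Poly_Mapping.keys x. \<Sum>h\<in>Poly_Mapping.keys s.
        Poly_Mapping.single (g * h)
          (act (Poly_Mapping.lookup x g) (\<sigma> g (Poly_Mapping.lookup s h) * c g h)))"

definition S_prime ::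
  "('g::monoid_mult \<Rightarrow> 'r::ring_1 \<Rightarrow> 'r) \<Rightarrow> ('g \<Rightarrow> 'g \<Rightarrow> 'r) \<Rightarrow>
     ('m::ab_group_add \<Rightarrow> 'r \<Rightarrow> 'm) \<Rightarrow> bool" where
  "S_prime \<sigma> c act \<longleftrightarrow>
     prime_module (crossed_mult \<sigma> c) crossed_one (induced_act \<sigma> c act)"

definition G_stable :: "('g \<Rightarrow> 'r \<Rightarrow> 'r) \<Rightarrow> 'r set \<Rightarrow> bool" where
  "G_stable \<sigma> I \<longleftrightarrow> (\<forall>g. \<sigma> g ` I \<subseteq> I)"

definition pointwise_surjective :: "('g \<Rightarrow> 'r \<Rightarrow> 'r) \<Rightarrow> bool" where
  "pointwise_surjective \<sigma> \<longleftrightarrow> (\<forall>g. surj (\<sigma> g))"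


section \<open>The crossed product is a ring and the induced module is a module over it\<close>

lemma poly_mapping_single_add_induct:
  assumes "P 0" "\<And>g a. P (Poly_Mapping.single g a)" "\<And>x y. P x \<Longrightarrow> P y \<Longrightarrow> P (x + y)"
  shows "P (x :: 'g \<Rightarrow>\<^sub>0 'a::ab_group_add)"
proof (induction x rule: update_induct)
  case const
  show ?case by (rule assms(1))
next
  case (update f a b)
  have "Poly_Mapping.update a b f = f + Poly_Mapping.single a b"
    using update(1)
    by (intro poly_mapping_eqI)
      (auto simp: lookup_add lookup_update lookup_single when_def in_keys_iff)
  then show ?case using assms(2,3) update(3) by metis
qed

lemma sum_keys_additive:
  fixes f :: "'g \<Rightarrow> 'a::ab_group_add \<Rightarrow> 'b::ab_group_add"
  assumes "\<And>g a b. f g (a + b) = f g a + f g b"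
  shows "(\<Sum>g\<in>Poly_Mapping.keys (x + y). f g (Poly_Mapping.lookup (x + y) g)) =
    (\<Sum>g\<in>Poly_Mapping.keys x. f g (Poly_Mapping.lookup x g)) +
    (\<Sum>g\<in>Poly_Mapping.keys y. f g (Poly_Mapping.lookup y g))"
proof (rule setsum_keys_plus_distrib)
  show "f k 0 = 0" for k using assms[of k 0 0] by simp
qed (rule assms)

lemma sum_keys_single:
  fixes f :: "'g \<Rightarrow> 'a::ab_group_add \<Rightarrow> 'b::ab_group_add"
  assumes "f g 0 = 0"
  shows "(\<Sum>k\<in>Poly_Mapping.keys (Poly_Mapping.single g a).
    f k (Poly_Mapping.lookup (Poly_Mapping.single g a) k)) = f g a"
  using assms by (cases "a = 0") auto

context crossed_product
begin

lemma sigma_simps [simp]: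
  "\<sigma> g 1 = 1" "\<sigma> g (x + y) = \<sigma> g x + \<sigma> g y" "\<sigma> g (x * y) = \<sigma> g x * \<sigma> g y" "\<sigma> g 0 = 0"
proof -
  have e: "f 1 = 1 \<and> f (x + y) = f x + f y \<and> f (x * y) = f x * f y \<and> f 0 = 0"
    if "ring_endo f" for f :: "'r \<Rightarrow> 'r"
    using that unfolding ring_endo_def by (metis add_cancel_right_right)
  show "\<sigma> g 1 = 1" "\<sigma> g (x + y) = \<sigma> g x + \<sigma> g y" "\<sigma> g (x * y) = \<sigma> g x * \<sigma> g y" "\<sigma> g 0 = 0"
    using e[OF endo] by blast+
qed

lemma crossed_mult_eq_induced_act: "crossed_mult \<sigma> c = induced_act \<sigma> c (*)"
  by (intro ext) (simp add: crossed_mult_def induced_act_def mult.assoc)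

end

locale crossed_product_module =
  crossed_product \<sigma> c + M: right_module "(*)" "1 :: 'r" act
  for \<sigma> :: "'g::monoid_mult \<Rightarrow> 'r::ring_1 \<Rightarrow> 'r" and c :: "'g \<Rightarrow> 'g \<Rightarrow> 'r"
    and act :: "'m::ab_group_add \<Rightarrow> 'r \<Rightarrow> 'm"
begin

lemma act_zero [simp]: "act 0 r = 0" "act m 0 = 0"
  using M.act_add_left[of 0 0 r] M.act_add_right[of m 0 0] by simp_all

lemma induced_act_add_left:
  "induced_act \<sigma> c act (x + y) s = induced_act \<sigma> c act x s + induced_act \<sigma> c act y s"
  unfolding induced_act_def
  by (rule sum_keys_additive[where f = "\<lambda>g a. \<Sum>h\<in>Poly_Mapping.keys s.
        Poly_Mapping.single (g * h) (act a (\<sigma> g (Poly_Mapping.lookup s h) * c g h))"])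
    (simp add: M.act_add_left single_add sum.distrib)

lemma induced_act_add_right:
  "induced_act \<sigma> c act x (s + t) = induced_act \<sigma> c act x s + induced_act \<sigma> c act x t"
proof -
  have "(\<Sum>h\<in>Poly_Mapping.keys (s + t). Poly_Mapping.single (g * h)
            (act a (\<sigma> g (Poly_Mapping.lookup (s + t) h) * c g h))) =
        (\<Sum>h\<in>Poly_Mapping.keys s. Poly_Mapping.single (g * h)
            (act a (\<sigma> g (Poly_Mapping.lookup s h) * c g h))) +
        (\<Sum>h\<in>Poly_Mapping.keys t. Poly_Mapping.single (g * h)
            (act a (\<sigma> g (Poly_Mapping.lookup t h) * c g h)))" for g a
    by (rule sum_keys_additive[where f = "\<lambda>h b. Poly_Mapping.single (g * h)
          (act a (\<sigma> g b * c g h))"])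
      (simp add: distrib_right M.act_add_right single_add)
  then show ?thesis unfolding induced_act_def by (simp add: sum.distrib)
qed

lemma induced_act_zero [simp]:
  "induced_act \<sigma> c act 0 s = 0" "induced_act \<sigma> c act x 0 = 0"
  by (simp_all add: induced_act_def)

lemma induced_act_single:
  "induced_act \<sigma> c act (Poly_Mapping.single g m) (Poly_Mapping.single h r) =
     Poly_Mapping.single (g * h) (act m (\<sigma> g r * c g h))"
  by (cases "m = 0"; cases "r = 0") (simp_all add: induced_act_def)

end

sublocale crossed_product \<subseteq> R: crossed_product_module \<sigma> c "(*)"
  by unfold_locales (simp_all add: algebra_simps)

context crossed_product_module
begin

lemma induced_act_act:
  "induced_act \<sigma> c act (induced_act \<sigma> c act x s) t =
     induced_act \<sigma> c act x (crossed_mult \<sigma> c s t)"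
proof (induction x rule: poly_mapping_single_add_induct)
  case (2 g m)
  show ?case
  proof (induction s rule: poly_mapping_single_add_induct)
    case (2 h r)
    show ?case
    proof (induction t rule: poly_mapping_single_add_induct)
      case (2 i q)
      have "\<sigma> g r * c g h * (\<sigma> (g * h) q * c (g * h) i) =
            \<sigma> g r * (c g h * \<sigma> (g * h) q) * c (g * h) i" by (simp add: mult.assoc)
      also have "\<dots> = \<sigma> g r * (\<sigma> g (\<sigma> h q) * c g h) * c (g * h) i"
        by (simp only: twisted_action)
      also have "\<dots> = \<sigma> g r * \<sigma> g (\<sigma> h q) * (c g h * c (g * h) i)" by (simp add: mult.assoc)
      also have "\<dots> = \<sigma> g r * \<sigma> g (\<sigma> h q) * (\<sigma> g (c h i) * c g (h * i))"
        by (simp only: cocycle)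
      finally show ?case
        by (simp add: crossed_mult_eq_induced_act induced_act_single R.induced_act_single
            M.act_act mult.assoc)
    qed (simp_all add: crossed_mult_eq_induced_act induced_act_add_right R.induced_act_add_right)
  qed (simp_all add: crossed_mult_eq_induced_act induced_act_add_left induced_act_add_right
      R.induced_act_add_left)
qed (simp_all add: induced_act_add_left)

lemma induced_act_one: "induced_act \<sigma> c act x crossed_one = x"
  by (induction x rule: poly_mapping_single_add_induct)
    (simp_all add: crossed_one_def induced_act_add_left induced_act_single c_one_right M.act_one)

end

context crossed_product
begin

lemma crossed_mult_one_left: "crossed_mult \<sigma> c crossed_one s = s"
  unfolding crossed_mult_eq_induced_act
  by (induction s rule: poly_mapping_single_add_induct)
    (simp_all add: crossed_one_def R.induced_act_add_right R.induced_act_single c_one_left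
      sigma_one)

theorem crossed_product_ring: "unital_ring (crossed_mult \<sigma> c) crossed_one"
proof
  show "crossed_mult \<sigma> c (crossed_mult \<sigma> c a b) d = crossed_mult \<sigma> c a (crossed_mult \<sigma> c b d)"
    for a b d
    using R.induced_act_act by (simp add: crossed_mult_eq_induced_act)
qed (simp_all only: crossed_mult_one_left, simp_all only: crossed_mult_eq_induced_act
    R.induced_act_add_left R.induced_act_add_right R.induced_act_one)

end

context crossed_product_module
begin

theorem induced_right_module:
  "right_module (crossed_mult \<sigma> c) crossed_one (induced_act \<sigma> c act)"
  by (intro right_module.intro crossed_product_ring right_module_axioms.intro
      induced_act_add_left induced_act_add_right induced_act_act induced_act_one)

end


section \<open>The induced module is the tensor product\<close>

context crossed_product_module
begin

definition tensor :: "'m \<Rightarrow> ('g \<Rightarrow>\<^sub>0 'r) \<Rightarrow> ('g \<Rightarrow>\<^sub>0 'm)" where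
  "tensor m s = induced_act \<sigma> c act (Poly_Mapping.single 1 m) s"

lemma tensor_single: "tensor m (Poly_Mapping.single g r) = Poly_Mapping.single g (act m r)"
  by (simp add: tensor_def induced_act_single sigma_one c_one_left)

lemma tensor_add_left: "tensor (m + n) s = tensor m s + tensor n s"
  by (simp add: tensor_def single_add induced_act_add_left)

lemma tensor_add_right: "tensor m (s + t) = tensor m s + tensor m t"
  by (simp add: tensor_def induced_act_add_right)

lemma tensor_balanced:
  "tensor (act m r) s = tensor m (crossed_mult \<sigma> c (Poly_Mapping.single 1 r) s)"
  unfolding tensor_def induced_act_act[symmetric]
  by (simp add: induced_act_single c_one_left sigma_one)

lemma tensor_mult: "induced_act \<sigma> c act (tensor m s) t = tensor m (crossed_mult \<sigma> c s t)"
  by (simp add: tensor_def induced_act_act)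

theorem tensor_universal:
  fixes \<beta> :: "'m \<Rightarrow> ('g \<Rightarrow>\<^sub>0 'r) \<Rightarrow> 'a::ab_group_add"
  assumes l: "\<And>m n s. \<beta> (m + n) s = \<beta> m s + \<beta> n s"
    and r: "\<And>m s t. \<beta> m (s + t) = \<beta> m s + \<beta> m t"
    and b: "\<And>m r s. \<beta> (act m r) s = \<beta> m (crossed_mult \<sigma> c (Poly_Mapping.single 1 r) s)"
  shows "\<exists>!\<phi>. (\<forall>x y. \<phi> (x + y) = \<phi> x + \<phi> y) \<and> (\<forall>m s. \<phi> (tensor m s) = \<beta> m s)"
proof (rule ex1I)
  define \<phi> where "\<phi> x = (\<Sum>g\<in>Poly_Mapping.keys x.
      \<beta> (Poly_Mapping.lookup x g) (Poly_Mapping.single g 1))" for x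
  have z: "\<beta> 0 s = 0" "\<beta> m 0 = 0" for m s
    using l[of 0 0 s] r[of m 0 0] by simp_all
  have add: "\<phi> (x + y) = \<phi> x + \<phi> y" for x y
    unfolding \<phi>_def
    by (rule sum_keys_additive[where f = "\<lambda>g a. \<beta> a (Poly_Mapping.single g 1)"]) (rule l)
  have single: "\<phi> (Poly_Mapping.single g m) = \<beta> m (Poly_Mapping.single g 1)" for g m
    unfolding \<phi>_def
    by (rule sum_keys_single[where f = "\<lambda>g a. \<beta> a (Poly_Mapping.single g 1)"]) (rule z)
  have "\<phi> (tensor m s) = \<beta> m s" for m s
  proof (induction s rule: poly_mapping_single_add_induct)
    case 1
    show ?case by (simp add: tensor_def \<phi>_def z)
  next
    case (2 g a)
    show ?case
      by (simp add: tensor_single single b crossed_mult_eq_induced_act R.induced_act_single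
          c_one_left sigma_one)
  qed (simp add: tensor_add_right add r)
  with add show "(\<forall>x y. \<phi> (x + y) = \<phi> x + \<phi> y) \<and> (\<forall>m s. \<phi> (tensor m s) = \<beta> m s)"
    by blast
  fix \<psi> assume \<psi>: "(\<forall>x y. \<psi> (x + y) = \<psi> x + \<psi> y) \<and> (\<forall>m s. \<psi> (tensor m s) = \<beta> m s)"
  show "\<psi> = \<phi>"
  proof
    fix x
    show "\<psi> x = \<phi> x"
    proof (induction x rule: poly_mapping_single_add_induct)
      case 1
      show ?case using \<psi> add by (metis add_cancel_right_right)
    next
      case (2 g m)
      have "\<psi> (Poly_Mapping.single g m) = \<psi> (tensor m (Poly_Mapping.single g 1))"
        by (simp add: tensor_single M.act_one)
      then show ?case using \<psi> by (simp add: single)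
    next
      case (3 x y)
      then show ?case using \<psi> by (simp add: add)
    qed
  qed
qed

end

end

theory Submission
  imports Defs
begin

text \<open>The heart of the proof is that condition (2) makes \<open>M * G\<close> prime. Let \<open>s\<close> annihilate a
  nonzero submodule \<open>N\<close> and choose \<open>x \<in> N\<close> nonzero with support of minimal size. The unique
  product property applied to the supports of \<open>x\<close> and \<open>t = k-bar \<cdot> s\<close> gives a coefficient
  \<open>b\<close> of \<open>t\<close> such that \<open>x r b \<in> N\<close> has smaller support than \<open>x\<close> for all \<open>r \<in> R\<close>, whence
  \<open>x R b = 0\<close> by minimality. Removing this term from \<open>t\<close> and iterating shows \<open>x R b = 0\<close> for all
  coefficients \<open>b\<close> of \<open>t\<close>. Letting \<open>k\<close> vary, (2) applies to the coefficients of \<open>x\<close> and of \<open>s\<close>.\<close>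

section \<open>Cancellation in the monoid and conjugation by the twisting units\<close>

text \<open>If \<open>h\<close> and \<open>h'\<close> differed, neither pair in \<open>{k}\<close>
  times \<open>{h, h'}\<close> would have a unique product.\<close>

lemma unique_product_monoid_left_cancel:
  fixes k h h' :: "'g::monoid_mult"
  assumes "unique_product_monoid TYPE('g)" and "k * h = k * h'"
  shows "h = h'"
proof -
  obtain x y where "x \<in> {k}" "y \<in> {h, h'}"
    and "\<forall>(x', y') \<in> {k} \<times> {h, h'}. (x', y') \<noteq> (x, y) \<longrightarrow> x * y \<noteq> x' * y'"
    using assms(1)[unfolded unique_product_monoid_def, rule_format, of "{k}" "{h, h'}"] by auto
  then show ?thesis using assms(2) by auto
qed

text \<open>\<open>\<sigma>\<close> is an action only up to conjugation by \<open>c g h\<close>.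
  That \<open>u\<close> and \<open>v\<close> are the same for all \<open>b\<close> is what later
  yields \<open>G\<close>-stability of an ideal.\<close>

lemma (in crossed_product) sigma_sigma_conj:
  "\<exists>u v. \<forall>b. \<sigma> g (\<sigma> h b) = u * \<sigma> (g * h) b * v"
proof -
  obtain v where v: "c g h * v = 1"
    using unit_c[of g h] unfolding is_unit_of_ring_def by blast
  have "\<sigma> g (\<sigma> h b) = c g h * \<sigma> (g * h) b * v" for b
    using twisted_action[of g h b] v by (metis mult.assoc mult_1_right)
  then show ?thesis by blast
qed

context crossed_product_module
begin

lemma act_mult_unit_eq_0:
  assumes "is_unit_of_ring u" and "act m (a * u) = 0"
  shows "act m a = 0"
proof -
  obtain v where "u * v = 1" using assms(1) unfolding is_unit_of_ring_def by blast
  then have "act m a = act (act m (a * u)) v" by (simp add: M.act_act mult.assoc)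
  then show ?thesis using assms(2) by simp
qed

section \<open>Coefficients in \<open>M * G\<close> and the minimal support argument\<close>

lemma lookup_induced_act_unique:
  assumes "g \<in> Poly_Mapping.keys x" "h \<in> Poly_Mapping.keys s"
    and uniq: "\<And>g' h'. g' \<in> Poly_Mapping.keys x \<Longrightarrow> h' \<in> Poly_Mapping.keys s \<Longrightarrow>
      g' * h' = g * h \<Longrightarrow> g' = g \<and> h' = h"
  shows "Poly_Mapping.lookup (induced_act \<sigma> c act x s) (g * h) =
    act (Poly_Mapping.lookup x g) (\<sigma> g (Poly_Mapping.lookup s h) * c g h)"
proof -
  let ?f = "\<lambda>g' h'. act (Poly_Mapping.lookup x g') (\<sigma> g' (Poly_Mapping.lookup s h') * c g' h')"
  have "Poly_Mapping.lookup (induced_act \<sigma> c act x s) (g * h) =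
    (\<Sum>g'\<in>Poly_Mapping.keys x. \<Sum>h'\<in>Poly_Mapping.keys s. ?f g' h' when g' * h' = g * h)"
    by (simp add: induced_act_def lookup_sum lookup_single)
  also have "\<dots> = (\<Sum>g'\<in>Poly_Mapping.keys x. \<Sum>h'\<in>Poly_Mapping.keys s.
      if h' = h then if g' = g then ?f g h else 0 else 0)"
    by (intro sum.cong refl) (auto simp: when_def dest: uniq)
  also have "\<dots> = ?f g h" using assms(1,2) by simp
  finally show ?thesis .
qed

text \<open>Since \<open>c g 1 = 1\<close>, acting by \<open>R\<close> works coefficientwise and so
  cannot enlarge the support.\<close>

lemma lookup_induced_act_base:
  "Poly_Mapping.lookup (induced_act \<sigma> c act x (Poly_Mapping.single 1 r)) g =
    act (Poly_Mapping.lookup x g) (\<sigma> g r)"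
  by (induction x rule: poly_mapping_single_add_induct)
    (simp_all add: induced_act_single c_one_right lookup_single when_def
      induced_act_add_left lookup_add M.act_add_left)

text \<open>By left cancellation, multiplying by \<open>k-bar\<close> on the left never merges two
  coefficients of \<open>s\<close>.\<close>

lemma lookup_crossed_mult_basis:
  assumes "unique_product_monoid TYPE('g)"
  shows "Poly_Mapping.lookup (crossed_mult \<sigma> c (Poly_Mapping.single k 1) s) (k * h) =
    \<sigma> k (Poly_Mapping.lookup s h) * c k h"
  by (induction s rule: poly_mapping_single_add_induct)
    (auto simp: crossed_mult_eq_induced_act R.induced_act_single R.induced_act_add_right
      lookup_single lookup_add when_def distrib_right
      dest: unique_product_monoid_left_cancel[OF assms])

lemma induced_act_eq_0:
  assumes "\<And>g h m. act m (\<sigma> g (Poly_Mapping.lookup s h)) = 0"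
  shows "induced_act \<sigma> c act x s = 0"
  by (simp add: induced_act_def assms flip: M.act_act)

text \<open>Here \<open>\<And>g. act (act (lookup x g) (\<sigma> g r)) (\<sigma> g b) = 0\<close> says \<open>x r b = 0\<close>.\<close>

lemma minimal_support_annihilates_coefficients:
  assumes upm: "unique_product_monoid TYPE('g)"
    and N: "submodule (induced_act \<sigma> c act) N"
    and x: "x \<in> N" "x \<noteq> 0"
    and minimal: "\<And>y. y \<in> N \<Longrightarrow> y \<noteq> 0 \<Longrightarrow>
      card (Poly_Mapping.keys x) \<le> card (Poly_Mapping.keys y)"
    and "\<And>r. induced_act \<sigma> c act (induced_act \<sigma> c act x (Poly_Mapping.single 1 r)) t = 0"
  shows "act (act (Poly_Mapping.lookup x g) (\<sigma> g r)) (\<sigma> g (Poly_Mapping.lookup t h)) = 0"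
  using assms(6)
\<comment> \<open>Only \<open>t\<close> shrinks; \<open>x\<close> stays fixed, so its minimality
  remains available throughout.\<close>
proof (induction "card (Poly_Mapping.keys t)" arbitrary: t g r h rule: less_induct)
  case less
  define xr where "xr r = induced_act \<sigma> c act x (Poly_Mapping.single 1 r)" for r
  have xr: "xr r \<in> N" for r using N x(1) by (simp add: submodule_def xr_def)
  have lookup_xr: "Poly_Mapping.lookup (xr r) g = act (Poly_Mapping.lookup x g) (\<sigma> g r)" for r g
    by (simp add: xr_def lookup_induced_act_base)
  have keys_xr: "Poly_Mapping.keys (xr r) \<subseteq> Poly_Mapping.keys x" for r
    by (auto simp: in_keys_iff lookup_xr)
  show ?case
  proof (cases "t = 0")
    case False
    obtain g0 h0 where gh: "g0 \<in> Poly_Mapping.keys x" "h0 \<in> Poly_Mapping.keys t"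
      and uniq: "\<forall>(g', h') \<in> Poly_Mapping.keys x \<times> Poly_Mapping.keys t.
        (g', h') \<noteq> (g0, h0) \<longrightarrow> g0 * h0 \<noteq> g' * h'"
      using upm[unfolded unique_product_monoid_def, rule_format,
          of "Poly_Mapping.keys x" "Poly_Mapping.keys t"] x(2) False by auto
    let ?b = "Poly_Mapping.lookup t h0"
    \<comment> \<open>The support of \<open>xr r\<close> lies in that of \<open>x\<close>, so
      \<open>g0 * h0\<close> is still a unique product whenever \<open>g0\<close> survives. Its
      coefficient in \<open>(xr r) t = 0\<close> is then a single term, from which the unit
      \<open>c g0 h0\<close> can be stripped.\<close>
    have "act (Poly_Mapping.lookup (xr r) g0) (\<sigma> g0 ?b) = 0" for r
    proof (cases "g0 \<in> Poly_Mapping.keys (xr r)")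
      case True
      have "Poly_Mapping.lookup (induced_act \<sigma> c act (xr r) t) (g0 * h0) =
        act (Poly_Mapping.lookup (xr r) g0) (\<sigma> g0 ?b * c g0 h0)"
      proof (rule lookup_induced_act_unique[OF True gh(2)])
        fix g' h'
        assume "g' \<in> Poly_Mapping.keys (xr r)" "h' \<in> Poly_Mapping.keys t" "g' * h' = g0 * h0"
        then show "g' = g0 \<and> h' = h0" using uniq keys_xr[of r] by fastforce
      qed
      then show ?thesis
        using less.prems[of r] act_mult_unit_eq_0[OF unit_c] by (simp add: xr_def)
    qed (simp add: in_keys_iff)
    \<comment> \<open>The same vanishing says that \<open>x r b\<close> has lost the index
      \<open>g0\<close>, so its support is strictly smaller than that of \<open>x\<close>.\<close>
    then have g0: "Poly_Mapping.lookup (xr (r * ?b)) g0 = 0" for r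
      by (simp add: lookup_xr M.act_act)
    have zero: "xr (r * ?b) = 0" for r
    proof (rule ccontr)
      assume "xr (r * ?b) \<noteq> 0"
      then have "card (Poly_Mapping.keys x) \<le> card (Poly_Mapping.keys (xr (r * ?b)))"
        by (intro minimal xr)
      moreover have "Poly_Mapping.keys (xr (r * ?b)) \<subset> Poly_Mapping.keys x"
        using keys_xr[of "r * ?b"] g0[of r] gh(1) by (auto simp: in_keys_iff)
      ultimately show False by (meson finite_keys leD psubset_card_mono)
    qed
    then have b: "act (act (Poly_Mapping.lookup x g) (\<sigma> g r)) (\<sigma> g ?b) = 0" for g r
      using lookup_xr[of "r * ?b" g] by (simp add: M.act_act)
    define t' where "t' = t - Poly_Mapping.single h0 ?b"
    have t: "t = t' + Poly_Mapping.single h0 ?b" by (simp add: t'_def)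
    have lookup_t': "Poly_Mapping.lookup t' h = (if h = h0 then 0 else Poly_Mapping.lookup t h)"
      for h by (simp add: t'_def lookup_minus lookup_single)
    have "Poly_Mapping.keys t' \<subset> Poly_Mapping.keys t"
      using gh(2) by (auto simp: in_keys_iff lookup_t' split: if_splits)
    then have card: "card (Poly_Mapping.keys t') < card (Poly_Mapping.keys t)"
      by (simp add: psubset_card_mono)
    \<comment> \<open>The removed term is \<open>b\<close> times \<open>h0-bar\<close>, and
      \<open>x r b = 0\<close>; hence \<open>t'\<close> inherits the hypothesis on
      \<open>t\<close>.\<close>
    have "induced_act \<sigma> c act (xr r) t' = 0" for r
    proof -
      have "Poly_Mapping.single h0 ?b =
        crossed_mult \<sigma> c (Poly_Mapping.single 1 ?b) (Poly_Mapping.single h0 1)"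
        by (simp add: crossed_mult_eq_induced_act R.induced_act_single c_one_left)
      moreover have "induced_act \<sigma> c act (xr r) (Poly_Mapping.single 1 ?b) = xr (r * ?b)"
        by (simp add: xr_def induced_act_act crossed_mult_eq_induced_act R.induced_act_single
            sigma_one c_one_left)
      ultimately have "induced_act \<sigma> c act (xr r) (Poly_Mapping.single h0 ?b) = 0"
        by (simp add: zero flip: induced_act_act)
      then show ?thesis
        using less.prems[of r] induced_act_add_right[of "xr r" t' "Poly_Mapping.single h0 ?b"]
        by (simp add: xr_def flip: t)
    qed
    then have "act (act (Poly_Mapping.lookup x g) (\<sigma> g r)) (\<sigma> g (Poly_Mapping.lookup t' h)) = 0"
      using less.hyps[OF card] by (simp add: xr_def)
    then show ?thesis using b by (cases "h = h0") (simp_all add: lookup_t')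
  qed simp
qed

lemma S_prime_if_elementwise:
  assumes upm: "unique_product_monoid TYPE('g)"
    and nz: "\<exists>m::'m. m \<noteq> 0"
    and elementwise: "\<And>m b g. (\<And>h r. act (act m (\<sigma> g r)) (\<sigma> g (\<sigma> h b)) = 0) \<Longrightarrow>
      m = 0 \<or> (\<forall>h m'. act m' (\<sigma> h b) = 0)"
  shows "S_prime \<sigma> c act"
  unfolding S_prime_def prime_module_def
proof (intro conjI allI impI)
  show "right_module (crossed_mult \<sigma> c) crossed_one (induced_act \<sigma> c act)"
    by (rule induced_right_module)
  obtain m :: 'm where "m \<noteq> 0" using nz by blast
  then have "Poly_Mapping.single (1::'g) m \<noteq> 0"
    by (metis lookup_single_eq lookup_zero)
  then show "\<exists>x::'g \<Rightarrow>\<^sub>0 'm. x \<noteq> 0" by blast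
  fix N assume "submodule (induced_act \<sigma> c act) N \<and> N \<noteq> {0}"
  then have N: "submodule (induced_act \<sigma> c act) N" and "\<exists>x. x \<in> N \<and> x \<noteq> 0"
    by (auto simp: submodule_def)
  then obtain x where x: "x \<in> N" "x \<noteq> 0"
    and minimal: "\<And>y. y \<in> N \<Longrightarrow> y \<noteq> 0 \<Longrightarrow>
      card (Poly_Mapping.keys x) \<le> card (Poly_Mapping.keys y)"
    using ex_has_least_nat[of "\<lambda>x. x \<in> N \<and> x \<noteq> 0" _ "\<lambda>x. card (Poly_Mapping.keys x)"]
    by blast
  obtain g where g: "Poly_Mapping.lookup x g \<noteq> 0"
    using x(2) by (metis lookup_zero poly_mapping_eqI)
  have "induced_act \<sigma> c act y s = 0" if s: "\<And>x. x \<in> N \<Longrightarrow> induced_act \<sigma> c act x s = 0" for s y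
  proof (rule induced_act_eq_0)
    fix g' h m'
    \<comment> \<open>The twists by \<open>\<sigma> k\<close> that (2) asks for are, up to units,
      the coefficients of \<open>k-bar s\<close>. This product kills \<open>x r\<close> because
      \<open>x r k-bar\<close> lies in \<open>N\<close>.\<close>
    have "act (act (Poly_Mapping.lookup x g) (\<sigma> g r)) (\<sigma> g (\<sigma> k (Poly_Mapping.lookup s h))) = 0"
      for k r
    proof -
      let ?t = "crossed_mult \<sigma> c (Poly_Mapping.single k 1) s"
      have xt: "induced_act \<sigma> c act (induced_act \<sigma> c act x (Poly_Mapping.single 1 r)) ?t = 0" for r
        using N x(1) by (simp add: submodule_def s flip: induced_act_act)
      have "act (act (Poly_Mapping.lookup x g) (\<sigma> g r))
          (\<sigma> g (Poly_Mapping.lookup ?t (k * h))) = 0"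
        by (rule minimal_support_annihilates_coefficients[OF upm N x _ xt]) (rule minimal)
      moreover have "is_unit_of_ring (\<sigma> g (c k h))"
        using unit_c[of k h] unfolding is_unit_of_ring_def by (metis sigma_simps(1,3))
      ultimately show ?thesis
        using act_mult_unit_eq_0 by (simp add: lookup_crossed_mult_basis[OF upm])
    qed
    then show "act m' (\<sigma> g' (Poly_Mapping.lookup s h)) = 0" using elementwise g by blast
  qed
  then show "annihilator (induced_act \<sigma> c act) N = annihilator (induced_act \<sigma> c act) UNIV"
    unfolding annihilator_def by auto
qed

section \<open>Primeness and \<open>G\<close>-stable ideals\<close>

text \<open>An element \<open>b\<close> of \<open>B\<close> annihilates the submodule generated by
  \<open>m g-bar\<close>: moving \<open>b\<close> leftwards past \<open>r h-bar\<close> replaces it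
  by \<open>r * \<sigma> h b\<close>, again in \<open>B\<close>. Primeness extends this to all of
  \<open>M * G\<close>, in particular to the coefficient at the identity.\<close>

lemma S_prime_stable_ideal:
  assumes prime: "S_prime \<sigma> c act"
    and B: "two_sided_ideal B" "G_stable \<sigma> B"
    and mB: "\<And>b. b \<in> B \<Longrightarrow> act m (\<sigma> g b) = 0"
    and m: "m \<noteq> 0" and b: "b \<in> B"
  shows "act m' b = 0"
proof -
  let ?x = "Poly_Mapping.single g m"
  define N where "N = range (induced_act \<sigma> c act ?x)"
  have "submodule (induced_act \<sigma> c act) N"
    unfolding submodule_def N_def
    by (auto simp: induced_act_act simp flip: induced_act_add_right)
      (metis induced_act_zero(2) rangeI)
  moreover have "?x \<in> N" unfolding N_def by (metis induced_act_one rangeI)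
  then have "N \<noteq> {0}" using m by (metis lookup_single_eq lookup_zero singletonD)
  ultimately have ann: "annihilator (induced_act \<sigma> c act) N = annihilator (induced_act \<sigma> c act) UNIV"
    using prime unfolding S_prime_def prime_module_def by blast
  have "induced_act \<sigma> c act (induced_act \<sigma> c act ?x s) (Poly_Mapping.single 1 b) = 0" for s
  proof (induction s rule: poly_mapping_single_add_induct)
    case (2 h r)
    have "\<sigma> h b \<in> B" using B(2) b by (auto simp: G_stable_def)
    then have "r * \<sigma> h b \<in> B" using B(1) unfolding two_sided_ideal_def by blast
    then have "act (act m (\<sigma> g r * \<sigma> g (\<sigma> h b))) (c g h) = 0"
      using mB[of "r * \<sigma> h b"] by simp
    moreover have "\<sigma> g r * (c g h * \<sigma> (g * h) b) = \<sigma> g r * \<sigma> g (\<sigma> h b) * c g h"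
      by (simp add: mult.assoc twisted_action)
    ultimately show ?case
      by (simp add: induced_act_single M.act_act c_one_right mult.assoc)
  qed (simp_all add: induced_act_add_left induced_act_add_right)
  then have "Poly_Mapping.single 1 b \<in> annihilator (induced_act \<sigma> c act) N"
    by (auto simp: annihilator_def N_def)
  then have "Poly_Mapping.single 1 b \<in> annihilator (induced_act \<sigma> c act) UNIV"
    by (simp only: ann)
  then have "induced_act \<sigma> c act (Poly_Mapping.single 1 m') (Poly_Mapping.single 1 b) = 0"
    by (simp add: annihilator_def)
  then have "Poly_Mapping.single (1::'g) (act m' b) = 0"
    by (simp add: induced_act_single sigma_one c_one_left)
  then show ?thesis by (metis lookup_single_eq lookup_zero)
qed

lemma elementwise_if_stable_ideal:
  assumes ideal: "\<And>m B g. two_sided_ideal B \<Longrightarrow> G_stable \<sigma> B \<Longrightarrow>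
      (\<And>b. b \<in> B \<Longrightarrow> act m (\<sigma> g b) = 0) \<Longrightarrow> m = 0 \<or> (\<forall>m'. \<forall>b\<in>B. act m' b = 0)"
    and mb: "\<And>h r. act (act m (\<sigma> g r)) (\<sigma> g (\<sigma> h b)) = 0"
  shows "m = 0 \<or> (\<forall>h m'. act m' (\<sigma> h b) = 0)"
proof -
  \<comment> \<open>For fixed \<open>m\<close> and \<open>g\<close>, this collects all elements
    satisfying the hypothesis of (2).\<close>
  define B where "B = {a. \<forall>h r. act (act m (\<sigma> g r)) (\<sigma> g (\<sigma> h a)) = 0}"
  \<comment> \<open>The left factor is absorbed into \<open>r\<close>, the right one acts on zero.
    This form covers both the ideal axioms and, with \<open>u\<close> and \<open>v\<close> from
    \<open>sigma_sigma_conj\<close>, stability.\<close>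
  have mul: "act (act m (\<sigma> g r)) (\<sigma> g p * \<sigma> g (\<sigma> h a) * \<sigma> g q) = 0" if "a \<in> B" for a p q h r
  proof -
    have "act (act m (\<sigma> g r)) (\<sigma> g p * \<sigma> g (\<sigma> h a) * \<sigma> g q) =
        act (act (act m (\<sigma> g (r * p))) (\<sigma> g (\<sigma> h a))) (\<sigma> g q)"
      by (simp add: M.act_act mult.assoc)
    moreover have "act (act m (\<sigma> g (r * p))) (\<sigma> g (\<sigma> h a)) = 0"
      using that unfolding B_def by blast
    ultimately show ?thesis by (simp only: act_zero)
  qed
  have "a * q \<in> B" "q * a \<in> B" if "a \<in> B" for a q
    unfolding B_def
    using mul[OF that, where p = 1] mul[OF that, where q = 1] by simp_all
  moreover have "0 \<in> B" "\<And>a b. a \<in> B \<Longrightarrow> b \<in> B \<Longrightarrow> a + b \<in> B"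
    by (simp_all add: B_def M.act_add_right)
  ultimately have "two_sided_ideal B" unfolding two_sided_ideal_def by blast
  moreover have stable: "G_stable \<sigma> B"
  proof -
    have "\<sigma> k a \<in> B" if a: "a \<in> B" for k a
      unfolding B_def
    proof (intro CollectI allI)
      fix h r
      obtain u v where "\<forall>b. \<sigma> h (\<sigma> k b) = u * \<sigma> (h * k) b * v"
        using sigma_sigma_conj by blast
      then show "act (act m (\<sigma> g r)) (\<sigma> g (\<sigma> h (\<sigma> k a))) = 0" using mul[OF a] by simp
    qed
    then show ?thesis by (auto simp: G_stable_def)
  qed
  moreover have "act m (\<sigma> g a) = 0" if "a \<in> B" for a
  proof -
    have "act (act m (\<sigma> g 1)) (\<sigma> g (\<sigma> 1 a)) = 0" using that unfolding B_def by blast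
    then show ?thesis by (simp add: M.act_one sigma_one)
  qed
  ultimately have "m = 0 \<or> (\<forall>m'. \<forall>b\<in>B. act m' b = 0)" by (rule ideal)
  moreover have "b \<in> B" using mb by (simp add: B_def)
  then have "\<sigma> h b \<in> B" for h using stable by (auto simp: G_stable_def)
  ultimately show ?thesis by blast
qed

section \<open>Passing from elements to submodules\<close>

lemma cyclic_submodule: "submodule act (range (act m))" "m \<in> range (act m)"
proof -
  show "m \<in> range (act m)" by (metis M.act_one rangeI)
  show "submodule act (range (act m))"
    unfolding submodule_def
    by (auto simp: M.act_act simp flip: M.act_add_right) (metis act_zero(2) rangeI)
qed

text \<open>The issue is the factor \<open>r\<close> between \<open>m\<close> and
  \<open>\<sigma> g b\<close>. Commutativity moves it to the right; surjectivity writes it as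
  \<open>\<sigma> g q\<close>, and \<open>q * b\<close> stays in \<open>B\<close>.\<close>

lemma cyclic_annihilated_by_stable_ideal:
  assumes "(\<forall>a b::'r. a * b = b * a) \<or> pointwise_surjective \<sigma>"
    and "two_sided_ideal B" and "\<And>b. b \<in> B \<Longrightarrow> act m (\<sigma> g b) = 0"
    and "b \<in> B"
  shows "act (act m r) (\<sigma> g b) = 0"
  using assms(1)
proof
  assume "\<forall>a b::'r. a * b = b * a"
  then have "act (act m r) (\<sigma> g b) = act (act m (\<sigma> g b)) r" by (metis M.act_act)
  then show ?thesis using assms(3,4) by simp
next
  assume "pointwise_surjective \<sigma>"
  then obtain q where "r = \<sigma> g q" unfolding pointwise_surjective_def by (meson surj_def)
  then have "act (act m r) (\<sigma> g b) = act m (\<sigma> g (q * b))" by (simp add: M.act_act)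
  moreover have "q * b \<in> B" using assms(2,4) unfolding two_sided_ideal_def by blast
  then have "act m (\<sigma> g (q * b)) = 0" by (rule assms(3))
  ultimately show ?thesis by simp
qed

end

theorem proposition4p9:
  fixes \<sigma> :: "'g::monoid_mult \<Rightarrow> 'r::ring_1 \<Rightarrow> 'r"
    and c :: "'g \<Rightarrow> 'g \<Rightarrow> 'r"
    and act :: "'m::ab_group_add \<Rightarrow> 'r \<Rightarrow> 'm"
  assumes "unique_product_monoid TYPE('g)"
    and "crossed_product \<sigma> c"
    and "right_module (*) 1 act"
    and "\<exists>m::'m. m \<noteq> 0"
  shows "(S_prime \<sigma> c act \<longleftrightarrow>
           (\<forall>m b g. (\<forall>h r. act (act m (\<sigma> g r)) (\<sigma> g (\<sigma> h b)) = 0) \<longrightarrow>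
              m = 0 \<or> (\<forall>h m'. act m' (\<sigma> h b) = 0))) \<and>
         (S_prime \<sigma> c act \<longleftrightarrow>
           (\<forall>m B. two_sided_ideal B \<and> G_stable \<sigma> B \<and> (\<exists>g. \<forall>b\<in>B. act m (\<sigma> g b) = 0) \<longrightarrow>
              m = 0 \<or> (\<forall>m'. \<forall>b\<in>B. act m' b = 0))) \<and>
         ((\<forall>a b::'r. a * b = b * a) \<or> pointwise_surjective \<sigma> \<longrightarrow>
           (S_prime \<sigma> c act \<longleftrightarrow>
             (\<forall>N B. submodule act N \<and> two_sided_ideal B \<and> G_stable \<sigma> B \<and>
                  (\<exists>g. \<forall>n\<in>N. \<forall>b\<in>B. act n (\<sigma> g b) = 0) \<longrightarrow>
                N = {0} \<or> (\<forall>m'. \<forall>b\<in>B. act m' b = 0))))"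
    (is "(_ \<longleftrightarrow> ?elementwise) \<and> (_ \<longleftrightarrow> ?ideal) \<and> (?side \<longrightarrow> (_ \<longleftrightarrow> ?submodule))")
proof -
  interpret crossed_product \<sigma> c by fact
  interpret right_module "(*)" "1 :: 'r" act by fact
  interpret crossed_product_module \<sigma> c act ..
  \<comment> \<open>The implications (2) to (1) to (3) to (2) close a cycle; (4) is then compared
    with (3).\<close>
  have two_one: "S_prime \<sigma> c act" if ?elementwise
    using S_prime_if_elementwise[OF assms(1,4)] that by blast
  have one_three: ?ideal if "S_prime \<sigma> c act"
    using S_prime_stable_ideal[OF that] by blast
  have three_two: ?elementwise if ?ideal
    using elementwise_if_stable_ideal that by blast
  have three_four: ?submodule if ?ideal
  proof (intro allI impI)
    fix N B
    assume *: "submodule act N \<and> two_sided_ideal B \<and> G_stable \<sigma> B \<and>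
      (\<exists>g. \<forall>n\<in>N. \<forall>b\<in>B. act n (\<sigma> g b) = 0)"
    show "N = {0} \<or> (\<forall>m'. \<forall>b\<in>B. act m' b = 0)"
    proof (cases "N = {0}")
      case False
      \<comment> \<open>One nonzero element of \<open>N\<close> suffices to invoke (3).\<close>
      then obtain n where "n \<in> N" "n \<noteq> 0" using * by (auto simp: submodule_def)
      then show ?thesis using that * by blast
    qed simp
  qed
  have four_three: ?ideal if ?side ?submodule
  proof (intro allI impI)
    fix m B
    assume *: "two_sided_ideal B \<and> G_stable \<sigma> B \<and> (\<exists>g. \<forall>b\<in>B. act m (\<sigma> g b) = 0)"
    then obtain g where "\<And>b. b \<in> B \<Longrightarrow> act m (\<sigma> g b) = 0" by blast
    \<comment> \<open>Condition (4) is applied to the cyclic submodule of \<open>m\<close>, which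
      contains \<open>m\<close> and so vanishes only if \<open>m = 0\<close>.\<close>
    then have "\<forall>n\<in>range (act m). \<forall>b\<in>B. act n (\<sigma> g b) = 0"
      using cyclic_annihilated_by_stable_ideal[OF that(1)] * by blast
    then have "range (act m) = {0} \<or> (\<forall>m'. \<forall>b\<in>B. act m' b = 0)"
      using that(2) * cyclic_submodule(1)[of m] by blast
    then show "m = 0 \<or> (\<forall>m'. \<forall>b\<in>B. act m' b = 0)" using cyclic_submodule(2)[of m] by blast
  qed
  have "S_prime \<sigma> c act \<longleftrightarrow> ?elementwise" "S_prime \<sigma> c act \<longleftrightarrow> ?ideal"
    using two_one one_three three_two by satx+
  moreover have "S_prime \<sigma> c act \<longleftrightarrow> ?submodule" if ?side
    using calculation(2) three_four four_three[OF that] by satx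
  ultimately show ?thesis by satx
qed

end
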